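(* Consider a multi-pursuer multi-evader pursuit-evasion problem in the Euclidean plane with $n$ pursuers of constant speeds $u_i$ and $m$ evaders of constant speeds $v_j$, where $\min_i u_i>\max_j v_j$ and each pursuer follows a constant bearing strategy with respect to the evader to which it is assigned. The Apollonius Allocation (A2) algorithm, run at every time instant to assign the pursuers to the evaders, guarantees capture of all the evaders in finite time.
   Context: **Agents and dynamics.** $\mathcal{P}=\{1,\dots,n\}$ and $\mathcal{E}=\{1,\dots,m\}$ index the pursuers and the evaders. Pursuer $i$ has position $p_i\in\mathbb{R}^2$, constant speed $u_i$ and heading $\theta_i$ (its control input): $\dot p_i=u_i(\cos\theta_i,\sin\theta_i)$. Evader $j$ has position $e_j\in\mathbb{R}^2$, constant speed $v_j$ and heading $\theta_j^E$ (its control input): $\dot e_j=v_j(\cos\theta_j^E,\sin\theta_j^E)$. The evaders can follow any strategy. The pursuers know the instantaneous positions and velocities of all the evaders. **Capture.** An evader is captured when one or more pursuers enter its capture zone, a disk of radius $\epsilon>0$ centered at the evader's instantaneous position. $\mathcal{E}_f$ is the set of evaders yet to be captured and $\mathcal{E}_c$ the set of evaders already captured, so $\mathcal{E}=\mathcal{E}_f\cup\mathcal{E}_c$. Once an evader is captured, it is removed from $\mathcal{E}_f$ and added to $\mathcal{E}_c$. **Constant bearing strategy.** If pursuer $i$ is assigned to evader $j$, let $\varphi$ be the angle of the vector $e_j-p_i$ (line-of-sight angle). The heading $\theta_i$ is the solution of $u_i\sin(\theta_i-\varphi)=v_j\sin(\theta_j^E-\varphi)$ for which $\frac{d}{dt}\|p_i-e_j\|=v_j\cos(\theta_j^E-\varphi)-u_i\cos(\theta_i-\varphi)<0$.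 Pursuers not assigned to any evader do not move. **Apollonius circles and active pursuers.** With $\rho_{ij}=v_j/u_i$, the Apollonius circle $\mathcal{A}_{ij}$ of pursuer $i$ and evader $j$ (the locus of points where capture occurs, over all headings of a non-maneuvering evader, when the pursuer uses constant bearing) is the circle with center $(e_j-\rho_{ij}^2p_i)/(1-\rho_{ij}^2)$ and radius $\rho_{ij}\|p_i-e_j\|/(1-\rho_{ij}^2)$, at the current positions. For a set $S\subseteq\mathcal{P}$ of pursuers, the Apollonius boundary around evader $j$ is $$\mathcal{B}_j(S)=\Big\{X\in\bigcup_{i\in S}\mathcal{A}_{ij}:\ [e_j,X]\cap\bigcup_{i\in S}\mathcal{A}_{ij}=\{X\}\Big\},$$ where $[e_j,X]$ is the line segment with endpoints $e_j$ and $X$. Pursuer $i\in S$ is classified as active for evader $j$, considering the pursuers in $S$, if $\mathcal{B}_j(S)\cap\mathcal{A}_{ij}\neq\varnothing$, and as redundant otherwise. Let $\mathrm{Act}_j(S)$ be the set of pursuers in $S$ that are active for evader $j$. **A2 algorithm** (run at every time instant with the current positions, until $\mathcal{E}_f$ is empty). Start with the initial allocation function $\mathscr{I}:\mathcal{E}_f\to2^{\mathcal{P}}$, $\mathscr{I}(j)=\mathrm{Act}_j(\mathcal{P})$. Let $\mathcal{P}_a=\bigcup_{j\in\mathcal{E}_f}\mathscr{I}(j)$ be the set of assigned pursuers, and let $\mathscr{J}:\mathcal{P}\to2^{\mathcal{E}_f}$, $\mathscr{J}(i)=\{j\in\mathcal{E}_f: i\in\mathscr{I}(j)\}$, be the dual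 function. (a) If $\mathrm{card}[\mathscr{J}(i)]\le1$ for all $i\in\mathcal{P}$, let $\mathscr{F}=\mathscr{I}$. Otherwise let $\mathscr{G}:\mathcal{E}_f\to2^{\mathcal{P}}$ be the intermediate allocation function $\mathscr{G}(j)=\big\{i\in\mathscr{I}(j): j=\mathrm{argmin}_{k\in\mathscr{J}(i)}\frac{\|p_i-e_k\|}{u_i+v_k}\big\}$. Thus each active pursuer is assigned to one evader, the minimizing one, among those to which it was assigned; $\mathscr{G}(j)$ can be empty for some $j$. (b) Let $\mathcal{P}_u=\mathcal{P}\setminus\mathcal{P}_a$ be the set of unassigned pursuers. For each evader $j\in\mathcal{E}_f$, find the active pursuers considering only the pursuers in $\mathscr{G}(j)\cup\mathcal{P}_u$; this gives the updated allocation function $\mathscr{I}'(j)=\mathrm{Act}_j(\mathscr{G}(j)\cup\mathcal{P}_u)$, with dual $\mathscr{J}'$. (c) Repeat (a) and (b), replacing $\mathscr{I}$ and $\mathscr{J}$ with $\mathscr{I}'$ and $\mathscr{J}'$, until $\mathscr{F}$ is obtained. $\mathscr{F}$ is the final allocation function: pursuer $i$ is assigned to evader $j$ if $i\in\mathscr{F}(j)$. *)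

theory Defs
  imports "HOL-Analysis.Analysis"
begin

type_synonym plane = "real^2"

definition direction :: "real \<Rightarrow> plane" where
  "direction \<theta> = vector [cos \<theta>, sin \<theta>]"


section \<open>Apollonius circles and active pursuers\<close>

text \<open>
  Agents are numbered by natural numbers.  \<open>u\<close> and \<open>v\<close> are the speeds and \<open>p\<close> and \<open>e\<close> the current
  positions of the pursuers and of the evaders.
\<close>

definition apollonius_circle :: "real \<Rightarrow> real \<Rightarrow> plane \<Rightarrow> plane \<Rightarrow> plane set" where
  "apollonius_circle ui vj pos ev =
     (let \<rho> = vj / ui
      in sphere ((1 / (1 - \<rho>\<^sup>2)) *\<^sub>R (ev - \<rho>\<^sup>2 *\<^sub>R pos)) (\<rho> * norm (pos - ev) / (1 - \<rho>\<^sup>2)))"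

definition apollonius_boundary ::
  "(nat \<Rightarrow> real) \<Rightarrow> (nat \<Rightarrow> real) \<Rightarrow> (nat \<Rightarrow> plane) \<Rightarrow> (nat \<Rightarrow> plane) \<Rightarrow> nat \<Rightarrow> nat set \<Rightarrow> plane set" where
  "apollonius_boundary u v p e j S =
     (let C = (\<Union>i\<in>S. apollonius_circle (u i) (v j) (p i) (e j))
      in {X \<in> C. closed_segment (e j) X \<inter> C = {X}})"

definition active_pursuers ::
  "(nat \<Rightarrow> real) \<Rightarrow> (nat \<Rightarrow> real) \<Rightarrow> (nat \<Rightarrow> plane) \<Rightarrow> (nat \<Rightarrow> plane) \<Rightarrow> nat \<Rightarrow> nat set \<Rightarrow> nat set" where
  "active_pursuers u v p e j S =
     {i \<in> S. apollonius_boundary u v p e j S \<inter> apollonius_circle (u i) (v j) (p i) (e j) \<noteq> {}}"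


section \<open>The A2 algorithm\<close>

text \<open>
  An allocation maps evaders to sets of pursuers; only its values on the set \<open>Ef\<close> of evaders yet
  to be captured matter.
\<close>

type_synonym allocation = "nat \<Rightarrow> nat set"

definition assigned_pursuers :: "nat set \<Rightarrow> allocation \<Rightarrow> nat set" where
  "assigned_pursuers Ef I = (\<Union>j\<in>Ef. I j)"

definition dual_allocation :: "nat set \<Rightarrow> allocation \<Rightarrow> nat \<Rightarrow> nat set" where
  "dual_allocation Ef I i = {j \<in> Ef. i \<in> I j}"

text \<open>
  \<open>a2_loop u v p e P Ef I F\<close>: the iteration started from the allocation \<open>I\<close> ends with \<open>F\<close>.
  The function \<open>\<sigma>\<close> chooses a minimizer for every assigned pursuer.  A minimizer need not be unique;
  ties may be broken in any way, and differently in different rounds.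
\<close>

inductive a2_loop ::
  "(nat \<Rightarrow> real) \<Rightarrow> (nat \<Rightarrow> real) \<Rightarrow> (nat \<Rightarrow> plane) \<Rightarrow> (nat \<Rightarrow> plane) \<Rightarrow> nat set \<Rightarrow> nat set
     \<Rightarrow> allocation \<Rightarrow> allocation \<Rightarrow> bool"
  for u v p e P Ef where
  stop: "(\<forall>i\<in>P. card (dual_allocation Ef I i) \<le> 1) \<Longrightarrow> a2_loop u v p e P Ef I I"
| round: "\<lbrakk> \<not> (\<forall>i\<in>P. card (dual_allocation Ef I i) \<le> 1);
     \<forall>i\<in>assigned_pursuers Ef I.
       is_arg_min (\<lambda>k. norm (p i - e k) / (u i + v k)) (\<lambda>k. k \<in> dual_allocation Ef I i) (\<sigma> i);
     G = (\<lambda>j. {i \<in> I j. j = \<sigma> i});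
     Pu = P - assigned_pursuers Ef I;
     I' = (\<lambda>j. active_pursuers u v p e j (G j \<union> Pu));
     a2_loop u v p e P Ef I' F \<rbrakk>
   \<Longrightarrow> a2_loop u v p e P Ef I F"

definition a2_allocation ::
  "(nat \<Rightarrow> real) \<Rightarrow> (nat \<Rightarrow> real) \<Rightarrow> (nat \<Rightarrow> plane) \<Rightarrow> (nat \<Rightarrow> plane) \<Rightarrow> nat set \<Rightarrow> nat set
     \<Rightarrow> allocation \<Rightarrow> bool" where
  "a2_allocation u v p e P Ef F \<longleftrightarrow>
     a2_loop u v p e P Ef (\<lambda>j. active_pursuers u v p e j P) F"

text \<open>The algorithm always terminates, so that it can be run at every configuration.\<close>

lemma active_pursuers_mono:
  assumes "i \<in> active_pursuers u v p e j S" "i \<in> S'" "S' \<subseteq> S"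
  shows "i \<in> active_pursuers u v p e j S'"
  using assms unfolding active_pursuers_def apollonius_boundary_def Let_def by blast

lemma a2_loop_terminates:
  assumes "finite P" "finite Ef"
    and "\<And>j. j \<in> Ef \<Longrightarrow> S j \<subseteq> P"
    and "\<And>j. j \<in> Ef \<Longrightarrow> P - assigned_pursuers Ef (\<lambda>j. active_pursuers u v p e j (S j)) \<subseteq> S j"
  shows "\<exists>F. a2_loop u v p e P Ef (\<lambda>j. active_pursuers u v p e j (S j)) F"
  using assms(3,4)
proof (induction "\<Sum>j\<in>Ef. card (S j)" arbitrary: S rule: less_induct)
  case less
  define I where "I = (\<lambda>j. active_pursuers u v p e j (S j))"
  show ?case
  proof (cases "\<forall>i\<in>P. card (dual_allocation Ef I i) \<le> 1")
    case True
    then show ?thesis unfolding I_def[symmetric] using a2_loop.stop by blast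
  next
    case False
    have I_sub: "I j \<subseteq> S j" for j by (auto simp: I_def active_pursuers_def)
    have "\<exists>k. is_arg_min (\<lambda>k. norm (p i - e k) / (u i + v k)) (\<lambda>k. k \<in> dual_allocation Ef I i) k"
      if "i \<in> assigned_pursuers Ef I" for i
      using that assms(2) ex_is_arg_min_if_finite[of "dual_allocation Ef I i"]
      by (auto simp: assigned_pursuers_def dual_allocation_def)
    then obtain \<sigma> where \<sigma>: "\<forall>i\<in>assigned_pursuers Ef I.
       is_arg_min (\<lambda>k. norm (p i - e k) / (u i + v k)) (\<lambda>k. k \<in> dual_allocation Ef I i) (\<sigma> i)"
      by metis
    then have \<sigma>_in: "\<sigma> i \<in> Ef \<and> i \<in> I (\<sigma> i)" if "i \<in> assigned_pursuers Ef I" for i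
      using that by (auto simp: is_arg_min_def dual_allocation_def)
    define G where "G = (\<lambda>j. {i \<in> I j. j = \<sigma> i})"
    define Pu where "Pu = P - assigned_pursuers Ef I"
    define S' where "S' = (\<lambda>j. G j \<union> Pu)"
    define I' where "I' = (\<lambda>j. active_pursuers u v p e j (S' j))"
    have sub: "S' j \<subseteq> S j" if "j \<in> Ef" for j
      using less.prems(2)[OF that] I_sub[of j] by (auto simp: S'_def G_def Pu_def I_def)
    have fin: "finite (S j)" if "j \<in> Ef" for j
      using less.prems(1)[OF that] assms(1) finite_subset by blast
    have "assigned_pursuers Ef I \<subseteq> assigned_pursuers Ef I'"
    proof
      fix i assume i: "i \<in> assigned_pursuers Ef I"
      then have "i \<in> I' (\<sigma> i)"
        using \<sigma>_in[OF i] sub[of "\<sigma> i"] active_pursuers_mono[of i u v p e "\<sigma> i" "S (\<sigma> i)" "S' (\<sigma> i)"]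
        by (auto simp: I'_def I_def S'_def G_def)
      then show "i \<in> assigned_pursuers Ef I'"
        using \<sigma>_in[OF i] by (auto simp: assigned_pursuers_def)
    qed
    then have prem2: "P - assigned_pursuers Ef I' \<subseteq> S' j" for j
      by (auto simp: S'_def Pu_def)
    from False obtain i where i: "i \<in> P" "\<not> card (dual_allocation Ef I i) \<le> 1" by blast
    then obtain j where j: "j \<in> dual_allocation Ef I i" "j \<noteq> \<sigma> i"
      by (metis card_le_Suc0_iff_eq One_nat_def card.infinite le0)
    then have "j \<in> Ef" "i \<in> S j" "i \<notin> S' j"
      using I_sub[of j]
      by (auto simp: dual_allocation_def S'_def G_def Pu_def assigned_pursuers_def)
    then have "card (S' j) < card (S j)"
      using sub[of j] fin[of j] by (metis psubsetI psubset_card_mono)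
    then have "(\<Sum>j\<in>Ef. card (S' j)) < (\<Sum>j\<in>Ef. card (S j))"
      using \<open>j \<in> Ef\<close> assms(2) sub fin by (intro sum_strict_mono_ex1) (auto intro: card_mono)
    moreover have "S' j \<subseteq> P" if "j \<in> Ef" for j
      using sub[OF that] less.prems(1)[OF that] by blast
    ultimately obtain F where "a2_loop u v p e P Ef I' F"
      using less.hyps[of S'] prem2 unfolding I'_def by blast
    then have "a2_loop u v p e P Ef I F"
      using a2_loop.round[OF False \<sigma> G_def Pu_def] by (simp add: I'_def S'_def)
    then show ?thesis unfolding I_def by blast
  qed
qed

lemma a2_allocation_exists:
  assumes "finite P" "finite Ef"
  shows "\<exists>F. a2_allocation u v p e P Ef F"
  unfolding a2_allocation_def using assms by (intro a2_loop_terminates) auto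


section \<open>Closed-loop dynamics\<close>

text \<open>
  Solutions are understood in the sense of Caratheodory, since the allocation, and with it the
  headings, may jump.  All speeds are bounded, so an absolutely continuous solution is the same as
  a Lipschitz one.
\<close>

definition solves_ode :: "(real \<Rightarrow> plane) \<Rightarrow> (real \<Rightarrow> plane) \<Rightarrow> bool" where
  "solves_ode x w \<longleftrightarrow>
     (\<exists>L. L-lipschitz_on {0..} x) \<and>
     (AE t in lebesgue. 0 < t \<longrightarrow> (x has_vector_derivative w t) (at t))"

text \<open>
  \<open>constant_bearing ui vj pos ev \<theta>E \<theta>\<close>: pursuer heading \<open>\<theta>\<close> is the constant bearing response to the
  evader heading \<open>\<theta>E\<close>; \<open>\<phi>\<close> is the line-of-sight angle, determined modulo \<open>2\<pi>\<close>.
\<close>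

definition constant_bearing :: "real \<Rightarrow> real \<Rightarrow> plane \<Rightarrow> plane \<Rightarrow> real \<Rightarrow> real \<Rightarrow> bool" where
  "constant_bearing ui vj pos ev \<theta>E \<theta> \<longleftrightarrow>
     (\<exists>\<phi>. ev - pos = norm (ev - pos) *\<^sub>R direction \<phi> \<and>
          ui * sin (\<theta> - \<phi>) = vj * sin (\<theta>E - \<phi>) \<and>
          vj * cos (\<theta>E - \<phi>) - ui * cos (\<theta> - \<phi>) < 0)"

definition captured_evaders ::
  "nat \<Rightarrow> nat \<Rightarrow> real \<Rightarrow> (nat \<Rightarrow> real \<Rightarrow> plane) \<Rightarrow> (nat \<Rightarrow> real \<Rightarrow> plane) \<Rightarrow> real \<Rightarrow> nat set" where
  "captured_evaders n m \<epsilon> p e t =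
     {j \<in> {1..m}. \<exists>s\<in>{0..t}. \<exists>i\<in>{1..n}. p i s \<in> cball (e j s) \<epsilon>}"

definition free_evaders ::
  "nat \<Rightarrow> nat \<Rightarrow> real \<Rightarrow> (nat \<Rightarrow> real \<Rightarrow> plane) \<Rightarrow> (nat \<Rightarrow> real \<Rightarrow> plane) \<Rightarrow> real \<Rightarrow> nat set" where
  "free_evaders n m \<epsilon> p e t = {1..m} - captured_evaders n m \<epsilon> p e t"

text \<open>
  A play of the game: positions \<open>p\<close>, \<open>e\<close>, headings \<open>\<theta>\<close>, \<open>\<theta>E\<close> and allocations \<open>F\<close> as functions of
  time.  The evaders' headings are unrestricted, so every evader strategy is covered.
\<close>

definition a2_play ::
  "nat \<Rightarrow> nat \<Rightarrow> (nat \<Rightarrow> real) \<Rightarrow> (nat \<Rightarrow> real) \<Rightarrow> real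
     \<Rightarrow> (nat \<Rightarrow> real \<Rightarrow> plane) \<Rightarrow> (nat \<Rightarrow> real \<Rightarrow> plane)
     \<Rightarrow> (nat \<Rightarrow> real \<Rightarrow> real) \<Rightarrow> (nat \<Rightarrow> real \<Rightarrow> real) \<Rightarrow> (real \<Rightarrow> allocation) \<Rightarrow> bool" where
  "a2_play n m u v \<epsilon> p e \<theta> \<theta>E F \<longleftrightarrow>
     (let Ef = free_evaders n m \<epsilon> p e in
       (\<forall>j\<in>{1..m}. solves_ode (e j) (\<lambda>t. v j *\<^sub>R direction (\<theta>E j t))) \<and>
       (\<forall>i\<in>{1..n}. solves_ode (p i)
          (\<lambda>t. if i \<in> assigned_pursuers (Ef t) (F t) then u i *\<^sub>R direction (\<theta> i t) else 0)) \<and>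
       (\<forall>t\<ge>0. a2_allocation u v (\<lambda>i. p i t) (\<lambda>j. e j t) {1..n} (Ef t) (F t)) \<and>
       (\<forall>t\<ge>0. \<forall>j\<in>Ef t. \<forall>i\<in>F t j.
          constant_bearing (u i) (v j) (p i t) (e j t) (\<theta>E j t) (\<theta> i t)))"

end

theory Submission
  imports Defs
begin

text \<open>
  Let \<open>M\<close> be the minimum of \<open>\<parallel>p\<^sub>i - e\<^sub>j\<parallel> / (u\<^sub>i + v\<^sub>j)\<close> over all pursuers \<open>i\<close> and all free evaders \<open>j\<close>.
  The point of the Apollonius circle \<open>A\<^sub>i\<^sub>j\<close> closest to \<open>e\<^sub>j\<close> is at distance
  \<open>v\<^sub>j \<parallel>p\<^sub>i - e\<^sub>j\<parallel> / (u\<^sub>i + v\<^sub>j)\<close> from it, so the pursuer of a minimizing pair is active for its evader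
  in every round, and the assignment rule (a) keeps it on an evader that attains \<open>M\<close>.  Hence at almost
  every time some pair attaining \<open>M\<close> closes in at speed at least \<open>u\<^sub>i - v\<^sub>j > 0\<close>, however the allocation
  switches.  While no evader is captured, the Lipschitz function \<open>M\<close> therefore decreases at a
  uniform rate, which it can do only for a finite time; then the set of free evaders shrinks.
\<close>

section \<open>The closest pursuer stays assigned\<close>

text \<open>With \<open>\<rho> = w / r\<close>, the center lies on the line through \<open>P\<close>
  and \<open>E\<close>, on the far side of \<open>E\<close> from \<open>P\<close>. The reverse
  triangle inequality bounds the distance from \<open>E\<close> to the circle below by the radius
  minus the offset of the center from \<open>E\<close>, and \<open>(\<rho> - \<rho>\<^sup>2) / (1 -
  \<rho>\<^sup>2) = \<rho> / (1 + \<rho>) = w / (r + w)\<close>.\<close>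

lemma apollonius_circle_dist_ge:
  assumes "0 \<le> w" "w < r" "Y \<in> apollonius_circle r w P E"
  shows "w * norm (P - E) / (r + w) \<le> norm (Y - E)"
proof -
  define \<rho> where "\<rho> = w / r"
  define C where "C = (1 / (1 - \<rho>\<^sup>2)) *\<^sub>R (E - \<rho>\<^sup>2 *\<^sub>R P)"
  have \<rho>: "0 \<le> \<rho>" "\<rho> < 1" "\<rho>\<^sup>2 < 1"
    using assms by (auto simp: \<rho>_def power_less_one_iff)
  have "C - E = (\<rho>\<^sup>2 / (1 - \<rho>\<^sup>2)) *\<^sub>R (E - P)"
  proof -
    \<comment> \<open>Both sides are multiplied by the nonzero factor
      \<open>1 - \<rho>\<^sup>2\<close>, so that the identity becomes linear and the factor can be
      cancelled.\<close>
    have "(1 - \<rho>\<^sup>2) *\<^sub>R (C - E) = (1 - \<rho>\<^sup>2) *\<^sub>R ((\<rho>\<^sup>2 / (1 - \<rho>\<^sup>2)) *\<^sub>R (E - P))"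
    proof -
      have "(1 - \<rho>\<^sup>2) *\<^sub>R (C - E) = (E - \<rho>\<^sup>2 *\<^sub>R P) - (1 - \<rho>\<^sup>2) *\<^sub>R E"
        using \<rho> by (simp add: C_def scaleR_diff_right[of "1 - \<rho>\<^sup>2" "_ *\<^sub>R _"])
      also have "\<dots> = \<rho>\<^sup>2 *\<^sub>R (E - P)" by (simp add: algebra_simps)
      finally show ?thesis using \<rho> by simp
    qed
    then show ?thesis using \<rho> scaleR_cancel_left[of "1 - \<rho>\<^sup>2"] by (metis less_irrefl right_minus_eq)
  qed
  then have CE: "norm (C - E) = \<rho>\<^sup>2 / (1 - \<rho>\<^sup>2) * norm (P - E)"
    using \<rho> by (simp add: norm_minus_commute)
  have "norm (C - Y) = \<rho> * norm (P - E) / (1 - \<rho>\<^sup>2)"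
    using assms(3) by (simp add: apollonius_circle_def Let_def \<rho>_def C_def dist_norm)
  moreover have "norm (C - Y) \<le> norm (C - E) + norm (Y - E)"
    using norm_triangle_ineq4[of "C - E" "Y - E"] by simp
  ultimately have "\<rho> * norm (P - E) / (1 - \<rho>\<^sup>2) - \<rho>\<^sup>2 / (1 - \<rho>\<^sup>2) * norm (P - E) \<le> norm (Y - E)"
    using CE by linarith
  moreover have "\<rho> / (1 - \<rho>\<^sup>2) - \<rho>\<^sup>2 / (1 - \<rho>\<^sup>2) = \<rho> / (1 + \<rho>)"
  proof -
    have "1 - \<rho>\<^sup>2 = (1 - \<rho>) * (1 + \<rho>)" "1 - \<rho> \<noteq> 0" "1 + \<rho> \<noteq> 0"
      using \<rho> by (auto simp: power2_eq_square algebra_simps)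
    moreover have "\<rho> - \<rho>\<^sup>2 = (1 - \<rho>) * \<rho>"
      by (simp add: power2_eq_square algebra_simps)
    ultimately show ?thesis
      by (simp add: diff_divide_distrib[symmetric])
  qed
  moreover have "\<rho> / (1 + \<rho>) = w / (r + w)"
    using assms by (simp add: \<rho>_def field_simps)
  ultimately show ?thesis
    by (metis left_diff_distrib times_divide_eq_left)
qed

text \<open>The preceding lower bound is attained where evader and pursuer meet if they run straight
  at each other: the point divides the segment from \<open>E\<close> to \<open>P\<close> in the
  ratio \<open>w : r\<close>.\<close>

lemma apollonius_circle_closest_point:
  assumes "0 \<le> w" "w < r"
  shows "E + (w / (r + w)) *\<^sub>R (P - E) \<in> apollonius_circle r w P E"
proof -
  define \<rho> where "\<rho> = w / r"
  define C where "C = (1 / (1 - \<rho>\<^sup>2)) *\<^sub>R (E - \<rho>\<^sup>2 *\<^sub>R P)"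
  define X where "X = E + (w / (r + w)) *\<^sub>R (P - E)"
  have \<rho>: "0 \<le> \<rho>" "\<rho> < 1" "\<rho>\<^sup>2 < 1"
    using assms by (auto simp: \<rho>_def power_less_one_iff)
  have X: "X = E + (\<rho> / (1 + \<rho>)) *\<^sub>R (P - E)"
    using assms by (simp add: \<rho>_def X_def field_simps)
  have fac: "1 - \<rho>\<^sup>2 = (1 - \<rho>) * (1 + \<rho>)"
    by (simp add: power2_eq_square algebra_simps)
  have ne: "1 + \<rho> \<noteq> 0" "1 - \<rho>\<^sup>2 \<noteq> 0" "1 - \<rho> \<noteq> 0" using \<rho> by auto
  have "(1 - \<rho>\<^sup>2) *\<^sub>R (C - X) = (1 - \<rho>\<^sup>2) *\<^sub>R ((\<rho> / (1 - \<rho>\<^sup>2)) *\<^sub>R (E - P))"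
  proof -
    have "(1 - \<rho>\<^sup>2) *\<^sub>R (C - X)
        = (E - \<rho>\<^sup>2 *\<^sub>R P) - (1 - \<rho>\<^sup>2) *\<^sub>R E - ((1 - \<rho>\<^sup>2) * (\<rho> / (1 + \<rho>))) *\<^sub>R (P - E)"
      using ne by (simp add: C_def X scaleR_diff_right scaleR_add_right)
    also have "(1 - \<rho>\<^sup>2) * (\<rho> / (1 + \<rho>)) = \<rho> - \<rho>\<^sup>2"
    proof -
      have "(1 - \<rho>\<^sup>2) * (\<rho> / (1 + \<rho>)) = (1 - \<rho>) * \<rho>" using ne(1) unfolding fac by simp
      then show ?thesis by (simp add: power2_eq_square algebra_simps)
    qed
    also have "(E - \<rho>\<^sup>2 *\<^sub>R P) - (1 - \<rho>\<^sup>2) *\<^sub>R E - (\<rho> - \<rho>\<^sup>2) *\<^sub>R (P - E) = \<rho> *\<^sub>R (E - P)"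
      by (simp add: algebra_simps)
    finally show ?thesis using ne by simp
  qed
  then have "C - X = (\<rho> / (1 - \<rho>\<^sup>2)) *\<^sub>R (E - P)"
    using ne(2) scaleR_cancel_left[of "1 - \<rho>\<^sup>2"] by blast
  then have "norm (C - X) = \<rho> * norm (P - E) / (1 - \<rho>\<^sup>2)"
    using \<rho> by (simp add: norm_minus_commute)
  then show ?thesis
    by (simp add: apollonius_circle_def Let_def \<rho>_def[symmetric] C_def[symmetric]
        X_def[symmetric] dist_norm)
qed

text \<open>The circle of pursuer \<open>k\<close> comes within \<open>v j\<close> times the ratio
  of \<open>k\<close> of the evader, and no nearer. So the smallest ratio yields a point
  \<open>X\<close> of the union of circles that is nearest to \<open>e j\<close>, and the segment
  from \<open>e j\<close> to \<open>X\<close> cannot meet the union earlier.\<close>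

lemma closest_pursuer_active:
  assumes "i \<in> S" "0 \<le> v j" "\<And>k. k \<in> S \<Longrightarrow> v j < u k"
    and min: "\<And>k. k \<in> S \<Longrightarrow> norm (p i - e j) / (u i + v j) \<le> norm (p k - e j) / (u k + v j)"
  shows "i \<in> active_pursuers u v p e j S"
proof -
  define C where "C = (\<Union>k\<in>S. apollonius_circle (u k) (v j) (p k) (e j))"
  define l where "l = v j / (u i + v j)"
  define X where "X = e j + l *\<^sub>R (p i - e j)"
  have X: "X \<in> apollonius_circle (u i) (v j) (p i) (e j)"
    unfolding X_def l_def by (rule apollonius_circle_closest_point) (use assms in auto)
  have l0: "0 \<le> l" using assms(1-3) by (force simp: l_def)
  have far: "norm (X - e j) \<le> norm (Y - e j)" if Y: "Y \<in> C" for Y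
  proof -
    obtain k where k: "k \<in> S" "Y \<in> apollonius_circle (u k) (v j) (p k) (e j)"
      using Y by (auto simp: C_def)
    have "norm (X - e j) = v j * (norm (p i - e j) / (u i + v j))"
      using l0 by (simp add: X_def) (simp add: l_def)
    also have "\<dots> \<le> v j * (norm (p k - e j) / (u k + v j))"
      by (intro mult_left_mono min k assms)
    also have "\<dots> \<le> norm (Y - e j)"
      using apollonius_circle_dist_ge[OF _ _ k(2)] assms k(1) by simp
    finally show ?thesis .
  qed
  have "Y = X" if Y: "Y \<in> closed_segment (e j) X" "Y \<in> C" for Y
  proof -
    obtain s where s: "0 \<le> s" "s \<le> 1" "Y = (1 - s) *\<^sub>R e j + s *\<^sub>R X"
      using Y(1) by (auto simp: closed_segment_def)
    have "Y - e j = s *\<^sub>R (X - e j)" by (simp add: s(3) algebra_simps)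
    then have "norm (X - e j) \<le> s * norm (X - e j)" using far[OF Y(2)] s by simp
    \<comment> \<open>The degenerate case \<open>X = e j\<close> arises when \<open>v j = 0\<close>
      or \<open>p i = e j\<close>; the segment is then a single point.\<close>
    then have "s = 1 \<or> X = e j"
      using s mult_le_cancel_right1[of "norm (X - e j)" s] by fastforce
    then show ?thesis using s(3) by (auto simp: algebra_simps)
  qed
  moreover have "X \<in> C" using X assms(1) by (auto simp: C_def)
  ultimately have "X \<in> apollonius_boundary u v p e j S"
    by (auto simp: apollonius_boundary_def C_def[symmetric] Let_def)
  then show ?thesis using X assms(1) by (auto simp: active_pursuers_def)
qed

text \<open>Minimality is over all pursuers and all free evaders at once: minimality over evaders
  matches the choice in step (a), minimality over pursuers makes the pursuer active. Several pairs
  may qualify.\<close>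

definition closest_pair ::
  "(nat \<Rightarrow> real) \<Rightarrow> (nat \<Rightarrow> real) \<Rightarrow> (nat \<Rightarrow> plane) \<Rightarrow> (nat \<Rightarrow> plane) \<Rightarrow> nat set \<Rightarrow> nat set
     \<Rightarrow> nat \<Rightarrow> nat \<Rightarrow> bool" where
  "closest_pair u v p e P Ef i j \<longleftrightarrow> i \<in> P \<and> j \<in> Ef \<and>
     (\<forall>k\<in>P. \<forall>l\<in>Ef. norm (p i - e j) / (u i + v j) \<le> norm (p k - e l) / (u k + v l))"

lemma closest_pair_active:
  assumes "closest_pair u v p e P Ef i j" "i \<in> S" "S \<subseteq> P"
    and "\<And>j. j \<in> Ef \<Longrightarrow> 0 \<le> v j" "\<And>i j. i \<in> P \<Longrightarrow> j \<in> Ef \<Longrightarrow> v j < u i"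
  shows "i \<in> active_pursuers u v p e j S"
  using assms by (intro closest_pursuer_active) (auto simp: closest_pair_def)

text \<open>Invariant of the rounds. The pursuer \<open>i\<close> stays fixed but its evader may
  change: step (a) picks \<open>\<sigma> i\<close>, whose ratio is at most that of the current
  evader and hence again the global minimum. Then \<open>i\<close> lies in
  \<open>G (\<sigma> i)\<close>, and a pursuer of a closest pair is active within any subset of
  \<open>P\<close> that contains it.\<close>

lemma a2_loop_keeps_closest:
  assumes "a2_loop u v p e P Ef I F"
    and speeds: "\<And>j. j \<in> Ef \<Longrightarrow> 0 \<le> v j" "\<And>i j. i \<in> P \<Longrightarrow> j \<in> Ef \<Longrightarrow> v j < u i"
    and "\<forall>j. I j \<subseteq> P" "\<exists>j. closest_pair u v p e P Ef i j \<and> i \<in> I j"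
  shows "\<exists>j. closest_pair u v p e P Ef i j \<and> i \<in> F j"
  using assms(1,4,5)
proof (induction rule: a2_loop.induct)
  case (stop I)
  then show ?case by blast
next
  case (round I \<sigma> G Pu I' F)
  from round.prems(2) obtain j where j: "closest_pair u v p e P Ef i j" "i \<in> I j" by blast
  then have "j \<in> dual_allocation Ef I i" "i \<in> assigned_pursuers Ef I"
    by (auto simp: closest_pair_def dual_allocation_def assigned_pursuers_def)
  with round.hyps(2) have \<sigma>: "\<sigma> i \<in> Ef" "i \<in> I (\<sigma> i)"
      "norm (p i - e (\<sigma> i)) / (u i + v (\<sigma> i)) \<le> norm (p i - e j) / (u i + v j)"
    by (force simp: is_arg_min_linorder dual_allocation_def)+
  then have close: "closest_pair u v p e P Ef i (\<sigma> i)"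
    using j(1) unfolding closest_pair_def by (meson order_trans)
  have sub: "G k \<union> Pu \<subseteq> P" for k
    using round.prems(1) by (auto simp: round.hyps(3,4))
  have "i \<in> I' (\<sigma> i)"
    unfolding round.hyps(5)
    by (rule closest_pair_active[OF close _ sub speeds]) (use \<sigma> in \<open>auto simp: round.hyps(3)\<close>)
  moreover have "\<forall>k. I' k \<subseteq> P"
    using sub by (auto simp: round.hyps(5) active_pursuers_def)
  ultimately show ?case using round.IH close by blast
qed

lemma a2_allocation_closest:
  assumes "a2_allocation u v p e P Ef F" "finite P" "finite Ef" "P \<noteq> {}" "Ef \<noteq> {}"
    and speeds: "\<And>j. j \<in> Ef \<Longrightarrow> 0 \<le> v j" "\<And>i j. i \<in> P \<Longrightarrow> j \<in> Ef \<Longrightarrow> v j < u i"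
  obtains i j where "closest_pair u v p e P Ef i j" "i \<in> F j"
proof -
  have "finite (P \<times> Ef)" "P \<times> Ef \<noteq> {}" using assms by auto
  from ex_is_arg_min_if_finite[OF this, of "\<lambda>(i, j). norm (p i - e j) / (u i + v j)"]
  obtain i j where ij: "closest_pair u v p e P Ef i j"
    by (auto simp: is_arg_min_linorder closest_pair_def)
  have "i \<in> active_pursuers u v p e j P"
    by (rule closest_pair_active[OF ij _ _ speeds]) (use ij in \<open>auto simp: closest_pair_def\<close>)
  then have "\<exists>j. closest_pair u v p e P Ef i j \<and> i \<in> active_pursuers u v p e j P"
    using ij by blast
  moreover have "\<forall>j. active_pursuers u v p e j P \<subseteq> P" by (auto simp: active_pursuers_def)
  ultimately have "\<exists>j. closest_pair u v p e P Ef i j \<and> i \<in> F j"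
    using a2_loop_keeps_closest[OF assms(1)[unfolded a2_allocation_def] speeds] by blast
  then show ?thesis using that by blast
qed


section \<open>Closing speed under constant bearing\<close>

text \<open>The velocity components across the line of sight cancel, so the closing speed is
  \<open>a - w * c\<close> with \<open>a\<^sup>2 = r\<^sup>2 - w\<^sup>2 + (w * c)\<^sup>2\<close>.
  The worst case is \<open>c = 1\<close>, an evader fleeing straight away, where the speed is
  \<open>r - w\<close>.\<close>

lemma constant_bearing_closing_speed:
  assumes "constant_bearing r w P E \<theta>E \<theta>" "0 \<le> w" "w < r"
  shows "(P - E) \<bullet> (r *\<^sub>R direction \<theta> - w *\<^sub>R direction \<theta>E) \<le> - (r - w) * norm (P - E)"
proof -
  obtain \<phi> where \<phi>: "E - P = norm (E - P) *\<^sub>R direction \<phi>"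
      "r * sin (\<theta> - \<phi>) = w * sin (\<theta>E - \<phi>)"
      "w * cos (\<theta>E - \<phi>) - r * cos (\<theta> - \<phi>) < 0"
    using assms(1) by (auto simp: constant_bearing_def)
  define a where "a = r * cos (\<theta> - \<phi>)"
  define c where "c = cos (\<theta>E - \<phi>)"
  have dir: "direction \<phi> \<bullet> direction \<alpha> = cos (\<alpha> - \<phi>)" for \<alpha>
    by (simp add: direction_def inner_vec_def sum_2 cos_diff)
  have "c \<le> 1" "-1 \<le> c" by (auto simp: c_def)
  have a2: "a\<^sup>2 = r\<^sup>2 - w\<^sup>2 + (w * c)\<^sup>2"
  proof -
    have "(r * sin (\<theta> - \<phi>))\<^sup>2 = (w * sin (\<theta>E - \<phi>))\<^sup>2" using \<phi>(2) by simp
    then show ?thesis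
      by (simp add: a_def c_def power_mult_distrib sin_squared_eq algebra_simps)
  qed
  have "a\<^sup>2 - (w * c + (r - w))\<^sup>2 = 2 * w * (r - w) * (1 - c)"
    unfolding a2 by (simp add: power2_eq_square algebra_simps)
  moreover have "0 \<le> 2 * w * (r - w) * (1 - c)" using assms \<open>c \<le> 1\<close> by simp
  ultimately have sq: "(w * c + (r - w))\<^sup>2 \<le> a\<^sup>2" by linarith
  \<comment> \<open>Comparing squares requires \<open>0 \<le> a\<close>. A negative \<open>a\<close>
    with \<open>\<bar>w * c\<bar> < \<bar>a\<bar>\<close> would lie below \<open>w * c\<close>,
    which the closing condition of constant bearing excludes.\<close>
  have "(w * c)\<^sup>2 < a\<^sup>2"
    unfolding a2 using assms by (simp add: power_strict_mono)
  then have "\<bar>w * c\<bar> < \<bar>a\<bar>" by (metis abs_le_square_iff not_le)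
  moreover have "w * c < a" using \<phi>(3) by (simp add: a_def c_def)
  ultimately have "0 \<le> a" by linarith
  then have "w * c + (r - w) \<le> a" using sq by (rule power2_le_imp_le[rotated])
  then have "(r - w) * norm (E - P) \<le> (a - w * c) * norm (E - P)"
    by (intro mult_right_mono) auto
  moreover have "(E - P) \<bullet> (r *\<^sub>R direction \<theta> - w *\<^sub>R direction \<theta>E) = norm (E - P) * (a - w * c)"
    by (subst \<phi>(1)) (simp add: inner_diff_right dir a_def c_def right_diff_distrib mult_ac)
  moreover have "(P - E) \<bullet> z = - ((E - P) \<bullet> z)" for z by (simp add: inner_diff_left)
  ultimately show ?thesis by (simp add: norm_minus_commute[of P] algebra_simps)
qed


section \<open>Descent of Lipschitz functions\<close>

text \<open>Consider the last time \<open>\<tau>\<close> at which \<open>h\<close> is at most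
  \<open>h a\<close>. It exists by continuity, and if it came before \<open>b\<close>, the local
  decrease to its right would produce a later such time.\<close>

lemma le_if_locally_decreasing_right:
  fixes h :: "real \<Rightarrow> real"
  assumes "a \<le> b" "continuous_on {a..b} h"
    and step: "\<And>t. a \<le> t \<Longrightarrow> t < b \<Longrightarrow> \<forall>\<^sub>F s in at_right t. h s \<le> h t"
  shows "h b \<le> h a"
proof -
  define A where "A = {t \<in> {a..b}. h t \<le> h a}"
  have "closed A"
    unfolding A_def by (intro continuous_on_closed_Collect_le assms continuous_on_const) auto
  have "a \<in> A" "bdd_above A" using assms(1) by (auto simp: A_def)
  define \<tau> where "\<tau> = Sup A"
  have "\<tau> \<in> A"
    unfolding \<tau>_def using \<open>closed A\<close> \<open>a \<in> A\<close> \<open>bdd_above A\<close> by (intro closed_contains_Sup) auto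
  have "\<not> \<tau> < b"
  proof
    assume "\<tau> < b"
    with \<open>\<tau> \<in> A\<close> have "\<forall>\<^sub>F s in at_right \<tau>. h s \<le> h \<tau>" by (intro step) (auto simp: A_def)
    then obtain d where d: "d > \<tau>" "\<And>s. \<tau> < s \<Longrightarrow> s < d \<Longrightarrow> h s \<le> h \<tau>"
      unfolding eventually_at_right_field by blast
    obtain s where s: "\<tau> < s" "s < d" "s < b"
      using dense[of \<tau> "min d b"] d(1) \<open>\<tau> < b\<close> by auto
    then have "s \<in> A" using d(2)[of s] \<open>\<tau> \<in> A\<close> by (auto simp: A_def)
    then have "s \<le> \<tau>" unfolding \<tau>_def using \<open>bdd_above A\<close> by (rule cSup_upper)
    then show False using s by simp
  qed
  then show ?thesis using \<open>\<tau> \<in> A\<close> by (auto simp: A_def)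
qed

text \<open>This serves to integrate a decrease known only at almost every time; the Lipschitz
  condition excludes growth concentrated on the null set \<open>N\<close>, as for the Cantor
  function. The decrease is stated as a one-sided upper estimate, since a minimum of distance ratios
  need not be differentiable.\<close>

lemma lipschitz_descent:
  fixes f :: "real \<Rightarrow> real"
  assumes "a \<le> b" "L-lipschitz_on {a..b} f" "negligible N" "0 \<le> c"
    and step: "\<And>t. a \<le> t \<Longrightarrow> t < b \<Longrightarrow> t \<notin> N \<Longrightarrow> \<forall>\<^sub>F s in at_right t. f s \<le> f t - c * (s - t)"
  shows "f b \<le> f a - c * (b - a)"
proof (rule field_le_epsilon)
  \<comment> \<open>With an open \<open>U \<supseteq> N\<close> of small measure, the term \<open>K * measure (U \<inter> {a..t})\<close> pays for any increase
    of \<open>f\<close> at the exceptional times, so \<open>h\<close> below decreases to the right of every point.\<close>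
  fix \<epsilon> :: real assume "0 < \<epsilon>"
  \<comment> \<open>\<open>f t + c * t\<close> grows at rate at most \<open>L + c\<close>.\<close>
  define K where "K = L + c"
  have "0 \<le> L" using assms(2) by (rule lipschitz_on_nonneg)
  then have "0 \<le> K" using assms(4) by (simp add: K_def)
  \<comment> \<open>Chosen so that \<open>K * \<eta> \<le> \<epsilon>\<close>; the
    \<open>+ 1\<close> covers \<open>K = 0\<close>.\<close>
  define \<eta> where "\<eta> = \<epsilon> / (K + 1)"
  have "0 < \<eta>" using \<open>0 < \<epsilon>\<close> \<open>0 \<le> K\<close> by (simp add: \<eta>_def)
  have N: "N \<in> null_sets lebesgue" using assms(3) by (simp add: negligible_iff_null_sets)
  obtain U where U: "open U" "N \<subseteq> U" "U - N \<in> lmeasurable" "emeasure lebesgue (U - N) < ennreal \<eta>"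
    using sets_lebesgue_outer_open[OF _ \<open>0 < \<eta>\<close>, of N] N by blast
  define \<mu> where "\<mu> = (\<lambda>t. measure lebesgue (U \<inter> {a..t}))"
  have meas: "U \<inter> {x..y} \<in> lmeasurable" "U \<inter> {x<..y} \<in> lmeasurable" for x y
    using U(1) by (auto intro!: bounded_set_imp_lmeasurable intro: bounded_Int)
  have split: "\<mu> s = \<mu> t + measure lebesgue (U \<inter> {t<..s})" if "a \<le> t" "t \<le> s" for t s
  proof -
    have "U \<inter> {a..s} = (U \<inter> {a..t}) \<union> (U \<inter> {t<..s})" using that by auto
    moreover have "(U \<inter> {a..t}) \<inter> (U \<inter> {t<..s}) = {}" by auto
    ultimately show ?thesis
      unfolding \<mu>_def using measure_Un3[OF meas(1)[of a t] meas(2)[of t s]] by simp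
  qed
  have inc: "\<mu> t \<le> \<mu> s" "\<mu> s \<le> \<mu> t + (s - t)" if "a \<le> t" "t \<le> s" for t s
  proof -
    show "\<mu> t \<le> \<mu> s" using split[OF that] by simp
    have "measure lebesgue (U \<inter> {t<..s}) \<le> measure lebesgue {t<..s}"
      using meas(2)
      by (intro measure_mono_fmeasurable) (auto intro: bounded_set_imp_lmeasurable)
    then show "\<mu> s \<le> \<mu> t + (s - t)" using split[OF that] that by simp
  qed
  have "1-lipschitz_on {a..b} \<mu>"
    by (rule lipschitz_on_leI) (use inc in \<open>auto simp: dist_real_def diff_le_eq add.commute\<close>)
  then have cont: "continuous_on {a..b} \<mu>" by (rule lipschitz_on_continuous_on)
  define h where "h = (\<lambda>t. f t + c * t - K * \<mu> t)"
  have "h b \<le> h a"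
  proof (rule le_if_locally_decreasing_right[OF assms(1)])
    show "continuous_on {a..b} h"
      unfolding h_def by (intro continuous_intros cont lipschitz_on_continuous_on[OF assms(2)])
    fix t assume t: "a \<le> t" "t < b"
    show "\<forall>\<^sub>F s in at_right t. h s \<le> h t"
    proof (cases "t \<in> N")
      case False
      from step[OF t False] eventually_at_right_less[of t] show ?thesis
      proof eventually_elim
        case (elim s)
        then have "K * \<mu> t \<le> K * \<mu> s" using inc(1)[of t s] t \<open>0 \<le> K\<close> by (intro mult_left_mono) auto
        then show ?case using elim by (simp add: h_def algebra_simps)
      qed
    next
      case True
      then obtain d where d: "d > 0" "ball t d \<subseteq> U"
        using U(1,2) by (meson open_contains_ball subsetD)
      have "\<forall>\<^sub>F s in at_right t. t < s \<and> s < min b (t + d)"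
        using t d(1) by (auto simp: eventually_at_right_field intro!: exI[of _ "min b (t + d)"])
      then show ?thesis
      proof eventually_elim
        case (elim s)
        \<comment> \<open>Near an exceptional time \<open>\<mu>\<close> grows at rate exactly one,
          so \<open>K * \<mu>\<close> outweighs the growth of \<open>f t + c * t\<close>.\<close>
        have "{t<..s} \<subseteq> U" using elim d(2) by (force simp: dist_real_def)
        then have "U \<inter> {t<..s} = {t<..s}" by blast
        then have eq: "\<mu> s = \<mu> t + (s - t)" using split[of t s] t elim by simp
        have "f s - f t \<le> L * (s - t)"
          using lipschitz_onD[OF assms(2), of s t] t elim by (auto simp: dist_real_def)
        then show ?case by (simp add: h_def K_def eq algebra_simps)
      qed
    qed
  qed
  moreover have "\<mu> a = 0"
  proof -
    have "negligible (U \<inter> {a..a})" by (rule negligible_subset[of "{a}"]) auto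
    then show ?thesis unfolding \<mu>_def by (rule negligible_imp_measure0)
  qed
  moreover have "K * \<mu> b \<le> \<epsilon>"
  proof -
    have "(U - N) \<union> N \<in> lmeasurable"
      using U(3) N by (rule fmeasurable.Un[OF _ fmeasurableI_null_sets])
    moreover have "U \<inter> {a..b} \<subseteq> (U - N) \<union> N" by blast
    ultimately have "\<mu> b \<le> measure lebesgue ((U - N) \<union> N)"
      unfolding \<mu>_def using fmeasurableD[OF meas(1)] by (intro measure_mono_fmeasurable)
    also have "\<dots> = measure lebesgue (U - N)"
      using U(3) N by (intro measure_Un_null_set) auto
    also have "\<dots> \<le> \<eta>"
      using U(3,4) \<open>0 < \<eta>\<close> by (simp add: emeasure_eq_measure2 ennreal_less_iff)
    finally have "K * \<mu> b \<le> K * \<eta>" using \<open>0 \<le> K\<close> by (rule mult_left_mono)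
    also have "\<dots> \<le> \<epsilon>" using \<open>0 < \<epsilon>\<close> \<open>0 \<le> K\<close> by (simp add: \<eta>_def field_simps)
    finally show ?thesis .
  qed
  ultimately show "f b \<le> f a - c * (b - a) + \<epsilon>" by (simp add: h_def algebra_simps)
qed

lemma lipschitz_on_Min:
  fixes f :: "'a \<Rightarrow> 'b::metric_space \<Rightarrow> real"
  assumes "finite A" "A \<noteq> {}" "\<And>a. a \<in> A \<Longrightarrow> L-lipschitz_on X (f a)"
  shows "L-lipschitz_on X (\<lambda>x. Min ((\<lambda>a. f a x) ` A))"
proof (rule lipschitz_onI)
  show "0 \<le> L" using assms by (meson ex_in_conv lipschitz_on_nonneg)
  \<comment> \<open>The index that attains the minimum at \<open>y\<close> is used as a competitor
    at \<open>x\<close>; exchanging \<open>x\<close> and \<open>y\<close> gives the other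
    half.\<close>
  have *: "Min ((\<lambda>a. f a x) ` A) \<le> Min ((\<lambda>a. f a y) ` A) + L * dist x y" if "x \<in> X" "y \<in> X" for x y
  proof -
    have "Min ((\<lambda>a. f a y) ` A) \<in> (\<lambda>a. f a y) ` A" using assms by (intro Min_in) auto
    then obtain a where a: "a \<in> A" "Min ((\<lambda>a. f a y) ` A) = f a y" by auto
    have "Min ((\<lambda>a. f a x) ` A) \<le> f a x" using assms(1) a(1) by simp
    also have "\<dots> \<le> f a y + L * dist x y"
      using lipschitz_onD[OF assms(3)[OF a(1)] that] by (simp add: dist_real_def)
    finally show ?thesis using a(2) by simp
  qed
  show "dist (Min ((\<lambda>a. f a x) ` A)) (Min ((\<lambda>a. f a y) ` A)) \<le> L * dist x y"
    if "x \<in> X" "y \<in> X" for x y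
    using *[OF that] *[OF that(2,1)] by (simp add: dist_real_def dist_commute abs_le_iff)
qed


section \<open>Progress of the play\<close>

text \<open>Where \<open>x t\<close> and \<open>y t\<close> differ, the norm is differentiable, and
  the ratio has derivative at most \<open>- d / q\<close>. The strict slack \<open>c < d / q\<close>
  turns this derivative at a single time into an inequality on an interval to its right.\<close>

lemma norm_ratio_locally_decreasing:
  fixes x y :: "real \<Rightarrow> 'a::real_inner"
  assumes "(x has_vector_derivative x') (at t)" "(y has_vector_derivative y') (at t)" "x t \<noteq> y t"
    and "(x t - y t) \<bullet> (x' - y') \<le> - d * norm (x t - y t)" "0 < q" "c < d / q"
  shows "\<forall>\<^sub>F s in at_right t. norm (x s - y s) / q \<le> norm (x t - y t) / q - c * (s - t)"
proof -
  define z where "z = (\<lambda>s. x s - y s)"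
  have "(z has_vector_derivative (x' - y')) (at t)"
    unfolding z_def by (intro has_vector_derivative_diff assms)
  then have "(z has_derivative (\<lambda>h. h *\<^sub>R (x' - y'))) (at t)"
    by (simp add: has_vector_derivative_def)
  moreover have "z t \<noteq> 0" using assms(3) by (simp add: z_def)
  ultimately have "((\<lambda>s. norm (z s)) has_derivative (\<lambda>h. (h *\<^sub>R (x' - y')) \<bullet> sgn (z t))) (at t)"
    by (intro has_derivative_compose[OF _ has_derivative_norm]) auto
  moreover have "(\<lambda>h. (h *\<^sub>R (x' - y')) \<bullet> sgn (z t)) = (*) ((x' - y') \<bullet> sgn (z t))"
    by (auto simp: fun_eq_iff)
  ultimately have "((\<lambda>s. norm (z s)) has_real_derivative (x' - y') \<bullet> sgn (z t)) (at t)"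
    by (simp add: has_field_derivative_def)
  then have "((\<lambda>s. norm (z s) / q + c * s) has_real_derivative
      ((x' - y') \<bullet> sgn (z t)) / q + c) (at t)"
    using assms(5) by (auto intro!: derivative_eq_intros)
  moreover have "((x' - y') \<bullet> sgn (z t)) / q + c < 0"
  proof -
    have "(x' - y') \<bullet> sgn (z t) = (z t \<bullet> (x' - y')) / norm (z t)"
      by (simp add: sgn_div_norm inner_commute divide_inverse mult.commute)
    also have "\<dots> \<le> - d"
      using assms(4) \<open>z t \<noteq> 0\<close> by (simp add: divide_le_eq z_def)
    finally have "((x' - y') \<bullet> sgn (z t)) / q \<le> - d / q"
      using assms(5) by (intro divide_right_mono) auto
    then show ?thesis using assms(6) by simp
  qed
  ultimately obtain \<delta> where \<delta>: "\<delta> > 0"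
      "\<And>h. 0 < h \<Longrightarrow> h < \<delta> \<Longrightarrow> norm (z (t + h)) / q + c * (t + h) < norm (z t) / q + c * t"
    using DERIV_neg_dec_right by blast
  have "norm (z s) / q \<le> norm (z t) / q - c * (s - t)" if "t < s" "s < t + \<delta>" for s
    using \<delta>(2)[of "s - t"] that by (simp add: algebra_simps)
  then show ?thesis
    using \<delta>(1) by (auto simp: eventually_at_right_field z_def intro!: exI[of _ "t + \<delta>"])
qed

lemma free_evaders_antimono:
  "s \<le> t \<Longrightarrow> free_evaders n m \<epsilon> p e t \<subseteq> free_evaders n m \<epsilon> p e s"
  by (force simp: free_evaders_def captured_evaders_def)

lemma free_evader_apart:
  assumes "j \<in> free_evaders n m \<epsilon> p e t" "i \<in> {1..n}" "0 \<le> t"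
  shows "\<epsilon> < norm (p i t - e j t)"
  using assms by (force simp: free_evaders_def captured_evaders_def dist_norm norm_minus_commute)

lemma a2_play_progress:
  assumes play: "a2_play n m u v \<epsilon> p e \<theta> \<theta>E F"
    and "n \<ge> 1" "\<epsilon> > 0"
    and v0: "\<And>j. j \<in> {1..m} \<Longrightarrow> 0 \<le> v j"
    and uv: "\<And>i j. i \<in> {1..n} \<Longrightarrow> j \<in> {1..m} \<Longrightarrow> v j < u i"
    and "0 \<le> t0" "free_evaders n m \<epsilon> p e t0 \<noteq> {}"
  shows "\<exists>t\<ge>t0. free_evaders n m \<epsilon> p e t \<subset> free_evaders n m \<epsilon> p e t0"
proof (rule ccontr)
  define Ef where "Ef = free_evaders n m \<epsilon> p e"
  define E where "E = Ef t0"
  assume "\<not> ?thesis"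
  \<comment> \<open>The free set can only shrink, so without a strict decrease it equals
    \<open>E\<close> at all later times. This fixes the index set of the minimum
    \<open>M\<close>.\<close>
  then have const: "Ef t = E" if "t0 \<le> t" for t
    using free_evaders_antimono[OF that, of n m \<epsilon> p e] that unfolding Ef_def E_def by blast
  have E: "E \<subseteq> {1..m}" "finite E" "E \<noteq> {}"
    using assms(7) finite_subset[of E "{1..m}"] by (auto simp: E_def Ef_def free_evaders_def)
  define A where "A = {1..n} \<times> E"
  have A: "finite A" "A \<noteq> {}" using E assms(2) by (auto simp: A_def)
  \<comment> \<open>A uniform lower bound for the rate at which the ratio of a pursued pair falls;
    positive because there are finitely many pairs.\<close>
  define \<kappa> where "\<kappa> = Min ((\<lambda>(i, j). (u i - v j) / (u i + v j)) ` A)"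
  have sum_pos: "0 < u i + v j" if "(i, j) \<in> A" for i j
    using that v0[of j] uv[of i j] E(1) by (force simp: A_def)
  have "0 < \<kappa>"
    unfolding \<kappa>_def using A sum_pos uv E(1) by (subst Min_gr_iff) (auto simp: A_def subset_iff)
  have \<kappa>_le: "\<kappa> \<le> (u i - v j) / (u i + v j)" if "(i, j) \<in> A" for i j
    unfolding \<kappa>_def using A that by (intro Min_le) force+
  define f where "f = (\<lambda>(i, j) t. norm (p i t - e j t) / (u i + v j))"
  define M where "M = (\<lambda>t. Min ((\<lambda>a. f a t) ` A))"
  define vel where "vel = (\<lambda>i t. if i \<in> assigned_pursuers (Ef t) (F t)
    then u i *\<^sub>R direction (\<theta> i t) else 0)"
  have e_ode: "solves_ode (e j) (\<lambda>t. v j *\<^sub>R direction (\<theta>E j t))" if "j \<in> {1..m}" for j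
    using play that by (auto simp: a2_play_def Let_def)
  have p_ode: "solves_ode (p i) (vel i)" if "i \<in> {1..n}" for i
    using play that by (auto simp: a2_play_def Let_def vel_def Ef_def)
  have "\<exists>L. L-lipschitz_on {0..} (f a)" if "a \<in> A" for a
  proof -
    obtain i j where ij: "a = (i, j)" "i \<in> {1..n}" "j \<in> E"
      using \<open>a \<in> A\<close> unfolding A_def by blast
    then have jm: "j \<in> {1..m}" using E(1) by blast
    obtain K L where "K-lipschitz_on {0..} (p i)" "L-lipschitz_on {0..} (e j)"
      using e_ode[OF jm] p_ode[OF ij(2)] by (auto simp: solves_ode_def)
    then have KL: "(K + L)-lipschitz_on {0..} (\<lambda>t. p i t - e j t)" by (rule lipschitz_on_diff)
    have "(K + L)-lipschitz_on {0..} (\<lambda>t. norm (p i t - e j t))"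
      by (rule lipschitz_onI)
        (use lipschitz_onD[OF KL] lipschitz_on_nonneg[OF KL]
           in \<open>auto simp: dist_norm intro: order_trans[OF norm_triangle_ineq3]\<close>)
    from lipschitz_on_cmult_real[OF this, of "1 / (u i + v j)"] show ?thesis
      by (auto simp: ij(1) f_def)
  qed
  then obtain Lf where Lf: "\<And>a. a \<in> A \<Longrightarrow> (Lf a)-lipschitz_on {0..} (f a)" by metis
  define K where "K = Max (Lf ` A)"
  have K: "K-lipschitz_on {0..} M"
    unfolding M_def using A Lf
    by (intro lipschitz_on_Min) (auto simp: K_def intro!: lipschitz_on_mono[OF Lf])
  \<comment> \<open>One null set serves all agents, since there are finitely many of them.\<close>
  obtain N where N: "negligible N" "\<And>t i. t \<notin> N \<Longrightarrow> 0 < t \<Longrightarrow> i \<in> {1..n} \<Longrightarrow>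
        (p i has_vector_derivative vel i t) (at t)"
      "\<And>t j. t \<notin> N \<Longrightarrow> 0 < t \<Longrightarrow> j \<in> {1..m} \<Longrightarrow>
        (e j has_vector_derivative v j *\<^sub>R direction (\<theta>E j t)) (at t)"
  proof -
    have "AE t in lebesgue. \<forall>i\<in>{1..n}. 0 < t \<longrightarrow> (p i has_vector_derivative vel i t) (at t)"
      using p_ode by (intro eventually_ball_finite) (auto simp: solves_ode_def)
    moreover have "AE t in lebesgue. \<forall>j\<in>{1..m}. 0 < t \<longrightarrow>
        (e j has_vector_derivative v j *\<^sub>R direction (\<theta>E j t)) (at t)"
      using e_ode by (intro eventually_ball_finite) (auto simp: solves_ode_def)
    ultimately have "AE t in lebesgue.
        (\<forall>i\<in>{1..n}. 0 < t \<longrightarrow> (p i has_vector_derivative vel i t) (at t)) \<and>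
        (\<forall>j\<in>{1..m}. 0 < t \<longrightarrow> (e j has_vector_derivative v j *\<^sub>R direction (\<theta>E j t)) (at t))"
      by (rule eventually_conj)
    then obtain N' where "negligible N'" "{t. \<not> ((\<forall>i\<in>{1..n}. 0 < t \<longrightarrow>
          (p i has_vector_derivative vel i t) (at t)) \<and>
        (\<forall>j\<in>{1..m}. 0 < t \<longrightarrow>
          (e j has_vector_derivative v j *\<^sub>R direction (\<theta>E j t)) (at t)))} \<subseteq> N'"
      unfolding eventually_ae_filter_negligible by blast
    then show thesis using that[of N'] by blast
  qed
  \<comment> \<open>Time 0 joins the exceptional set because derivatives are given only for positive
    times. Halving \<open>\<kappa>\<close> provides the strict slack needed to pass from a
    derivative to a local decrease.\<close>
  have step: "\<forall>\<^sub>F s in at_right t. M s \<le> M t - \<kappa> / 2 * (s - t)"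
    if t: "t0 \<le> t" "t \<notin> insert 0 N" for t
  proof -
    have "0 < t" using t assms(6) by auto
    have "a2_allocation u v (\<lambda>i. p i t) (\<lambda>j. e j t) {1..n} E (F t)"
      using play const[OF t(1)] \<open>0 < t\<close> by (auto simp: a2_play_def Let_def Ef_def)
    then obtain i j where ij: "closest_pair u v (\<lambda>i. p i t) (\<lambda>j. e j t) {1..n} E i j" "i \<in> F t j"
      by (rule a2_allocation_closest) (use E v0 uv assms(2) in auto)
    then have in_A: "(i, j) \<in> A" and i: "i \<in> {1..n}" and j: "j \<in> E" "j \<in> {1..m}"
      using E(1) by (auto simp: closest_pair_def A_def)
    have "M t = f (i, j) t"
      unfolding M_def
    proof (rule Min_eqI)
      show "f (i, j) t \<in> (\<lambda>a. f a t) ` A" using in_A by (rule imageI)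
      show "f (i, j) t \<le> y" if "y \<in> (\<lambda>a. f a t) ` A" for y
        using that ij(1) by (auto simp: closest_pair_def f_def A_def)
    qed (use A in simp)
    have "vel i t = u i *\<^sub>R direction (\<theta> i t)"
      using ij(2) j(1) const[OF t(1)] by (auto simp: vel_def assigned_pursuers_def)
    then have dp: "(p i has_vector_derivative u i *\<^sub>R direction (\<theta> i t)) (at t)"
      using N(2)[of t i] t(2) \<open>0 < t\<close> i by simp
    have de: "(e j has_vector_derivative v j *\<^sub>R direction (\<theta>E j t)) (at t)"
      using N(3)[of t j] t(2) \<open>0 < t\<close> j(2) by simp
    have "constant_bearing (u i) (v j) (p i t) (e j t) (\<theta>E j t) (\<theta> i t)"
      using play const[OF t(1)] \<open>0 < t\<close> j(1) ij(2) by (auto simp: a2_play_def Let_def Ef_def)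
    note closing = constant_bearing_closing_speed[OF this v0[OF j(2)] uv[OF i j(2)]]
    have "p i t \<noteq> e j t"
      using free_evader_apart[of j n m \<epsilon> p e t i] const[OF t(1)] j(1) i \<open>0 < t\<close> assms(3)
      by (auto simp: Ef_def)
    moreover have "\<kappa> / 2 < (u i - v j) / (u i + v j)"
      using \<open>0 < \<kappa>\<close> by (intro order_less_le_trans[OF _ \<kappa>_le[OF in_A]]) simp
    ultimately have "\<forall>\<^sub>F s in at_right t. f (i, j) s \<le> f (i, j) t - \<kappa> / 2 * (s - t)"
      using norm_ratio_locally_decreasing[OF dp de _ closing sum_pos[OF in_A]]
      unfolding f_def prod.case by blast
    \<comment> \<open>\<open>M\<close> lies below \<open>f (i, j)\<close> and touches it at
      \<open>t\<close>, so it inherits the decrease to the right of \<open>t\<close>, whichever pair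
      attains the minimum later.\<close>
    then show ?thesis
    proof (rule eventually_mono)
      fix s assume "f (i, j) s \<le> f (i, j) t - \<kappa> / 2 * (s - t)"
      moreover have "M s \<le> f (i, j) s" unfolding M_def using A(1) in_A by simp
      ultimately show "M s \<le> M t - \<kappa> / 2 * (s - t)" using \<open>M t = f (i, j) t\<close> by simp
    qed
  qed
  have pos: "0 < M t" if "t0 \<le> t" for t
  proof -
    have "0 < f a t" if "a \<in> A" for a
    proof -
      obtain i j where ij: "a = (i, j)" "i \<in> {1..n}" "j \<in> E" using \<open>a \<in> A\<close> unfolding A_def by blast
      then have "\<epsilon> < norm (p i t - e j t)"
        using const[OF \<open>t0 \<le> t\<close>] \<open>t0 \<le> t\<close> assms(6) by (intro free_evader_apart) (auto simp: Ef_def)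
      then have "0 < norm (p i t - e j t)" using assms(3) by linarith
      moreover have "0 < u i + v j" using sum_pos \<open>a \<in> A\<close> ij(1) by simp
      ultimately show ?thesis by (simp add: f_def ij(1))
    qed
    then show ?thesis unfolding M_def using A by simp
  qed
  \<comment> \<open>The time at which a line of slope \<open>- \<kappa> / 2\<close> starting from
    \<open>M t0\<close> reaches zero, contradicting the positivity of \<open>M\<close>.\<close>
  define b where "b = t0 + 2 * M t0 / \<kappa>"
  have "t0 \<le> b" using pos[of t0] \<open>0 < \<kappa>\<close> by (simp add: b_def)
  have "M b \<le> M t0 - \<kappa> / 2 * (b - t0)"
  proof (rule lipschitz_descent[OF \<open>t0 \<le> b\<close>])
    show "K-lipschitz_on {t0..b} M"
      using K by (rule lipschitz_on_mono) (use assms(6) in auto)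
    show "negligible (insert 0 N)" using N(1) by simp
  qed (use step \<open>0 < \<kappa>\<close> in auto)
  also have "\<dots> = 0" using \<open>0 < \<kappa>\<close> by (simp add: b_def)
  finally show False using pos[OF \<open>t0 \<le> b\<close>] by simp
qed

theorem mainTheorem1:
  fixes n m :: nat
    and u v :: "nat \<Rightarrow> real"
    and \<epsilon> :: real
    and p e :: "nat \<Rightarrow> real \<Rightarrow> real^2"
    and \<theta> \<theta>E :: "nat \<Rightarrow> real \<Rightarrow> real"
    and F :: "real \<Rightarrow> nat \<Rightarrow> nat set"
  assumes "n \<ge> 1" and "m \<ge> 1"
    and "\<And>j. j \<in> {1..m} \<Longrightarrow> v j \<ge> 0"
    and "Min (u ` {1..n}) > Max (v ` {1..m})"
    and "\<epsilon> > 0"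
    and "a2_play n m u v \<epsilon> p e \<theta> \<theta>E F"
  shows "\<exists>T\<ge>0. captured_evaders n m \<epsilon> p e T = {1..m}"
proof -
  have uv: "v j < u i" if "i \<in> {1..n}" "j \<in> {1..m}" for i j
  proof -
    have "v j \<le> Max (v ` {1..m})" using that by (intro Max_ge) auto
    moreover have "Min (u ` {1..n}) \<le> u i" using that by (intro Min_le) auto
    ultimately show ?thesis using assms(4) by linarith
  qed
  have "\<exists>T\<ge>0. free_evaders n m \<epsilon> p e T = {}" if "0 \<le> t" for t :: real
    using that
  \<comment> \<open>Each capture leaves fewer free evaders, and the argument restarts from the later
    time \<open>t'\<close>; hence \<open>t\<close> is arbitrary in the induction.\<close>
  proof (induction "card (free_evaders n m \<epsilon> p e t)" arbitrary: t rule: less_induct)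
    case less
    show ?case
    proof (cases "free_evaders n m \<epsilon> p e t = {}")
      case False
      then obtain t' where t': "t \<le> t'" "free_evaders n m \<epsilon> p e t' \<subset> free_evaders n m \<epsilon> p e t"
        using a2_play_progress[OF assms(6,1,5,3) uv less.prems] by blast
      have "finite (free_evaders n m \<epsilon> p e t)" by (simp add: free_evaders_def)
      then have "card (free_evaders n m \<epsilon> p e t') < card (free_evaders n m \<epsilon> p e t)"
        using t'(2) by (rule psubset_card_mono)
      moreover have "0 \<le> t'" using t'(1) less.prems by simp
      ultimately show ?thesis by (rule less.hyps)
    qed (use less.prems in blast)
  qed
  then obtain T where "0 \<le> T" "free_evaders n m \<epsilon> p e T = {}" by blast
  then show ?thesis by (auto simp: free_evaders_def captured_evaders_def)
qed

end
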